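(* Let $G$ be a $3$-connected split graph with at least $13$ vertices that is $\{K_{1,4},K_{1,4}+e\}$-free. Then $G$ is Hamilton-connected, i.e., for every pair of distinct vertices $u,v\in V(G)$ there is a path in $G$ with endpoints $u$ and $v$ that contains every vertex of $G$.
   Context: All graphs are finite, simple and connected. A connected graph $G$ is a split graph if its vertex set can be partitioned into a clique and an independent set (either possibly empty). A graph is $\{F_1,\dots,F_k\}$-free if it contains no induced subgraph isomorphic to any $F_i$. $K_{1,4}$ is the star with four leaves, and $K_{1,4}+e$ is the graph obtained from $K_{1,4}$ by adding one edge joining two nonadjacent vertices (i.e., joining two leaves). *)

theory Defs
  imports "Graph_Theory.Graph_Theory"
begin

text \<open>
  Finite simple graphs are the \<^locale>\<open>pair_graph\<close>s: an edge between \<open>u\<close> and \<open>v\<close> is the pair of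
  opposite arcs \<open>(u, v)\<close> and \<open>(v, u)\<close>.
\<close>

definition clique :: "'a pair_pre_digraph \<Rightarrow> 'a set \<Rightarrow> bool" where
  "clique G C \<longleftrightarrow> C \<subseteq> pverts G \<and> (\<forall>u\<in>C. \<forall>v\<in>C. u \<noteq> v \<longrightarrow> (u, v) \<in> parcs G)"

definition independent_set :: "'a pair_pre_digraph \<Rightarrow> 'a set \<Rightarrow> bool" where
  "independent_set G I \<longleftrightarrow> I \<subseteq> pverts G \<and> (\<forall>u\<in>I. \<forall>v\<in>I. (u, v) \<notin> parcs G)"

definition split_graph :: "'a pair_pre_digraph \<Rightarrow> bool" where
  "split_graph G \<longleftrightarrow> Digraph_Component.connected (with_proj G) \<and>
    (\<exists>C I. pverts G = C \<union> I \<and> C \<inter> I = {} \<and> clique G C \<and> independent_set G I)"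

definition k_connected :: "nat \<Rightarrow> 'a pair_pre_digraph \<Rightarrow> bool" where
  "k_connected k G \<longleftrightarrow> card (pverts G) > k \<and>
    (\<forall>S. S \<subseteq> pverts G \<and> card S < k \<longrightarrow>
      Digraph_Component.connected (with_proj G \<restriction> (pverts G - S)))"

definition induced_free :: "'b pair_pre_digraph set \<Rightarrow> 'a pair_pre_digraph \<Rightarrow> bool" where
  "induced_free \<F> G \<longleftrightarrow>
    \<not> (\<exists>F\<in>\<F>. \<exists>H. induced_subgraph H (with_proj G) \<and> digraph_iso H (with_proj F))"

definition K14 :: "nat pair_pre_digraph" where
  "K14 = \<lparr> pverts = {0, 1, 2, 3, 4}, parcs = {0} \<times> {1, 2, 3, 4} \<union> {1, 2, 3, 4} \<times> {0} \<rparr>"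

definition K14_plus_e :: "nat pair_pre_digraph" where
  "K14_plus_e = \<lparr> pverts = pverts K14, parcs = parcs K14 \<union> {(1, 2), (2, 1)} \<rparr>"

definition hamilton_connected :: "'a pair_pre_digraph \<Rightarrow> bool" where
  "hamilton_connected G \<longleftrightarrow> (\<forall>u\<in>pverts G. \<forall>v\<in>pverts G. u \<noteq> v \<longrightarrow>
    (\<exists>p. pre_digraph.apath (with_proj G) u p v \<and>
      set (pre_digraph.awalk_verts (with_proj G) u p) = pverts G))"

lemma K14_complete_bipartite: "complete_bipartite_digraph 1 4 (with_proj K14)"
  unfolding complete_bipartite_digraph_pair_def
proof (intro conjI exI)
  show "card {0::nat} = 1" "card {1, 2, 3, 4::nat} = 4" by simp_all
qed (auto simp: K14_def)

lemma pair_graph_K14_plus_e: "pair_graph K14_plus_e"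
  by unfold_locales (auto simp: K14_plus_e_def K14_def symmetric_def sym_def)

end

theory Submission
  imports Defs "HOL-Library.Disjoint_Sets" "HOL-Library.Sublist"
begin

text \<open>
  Write the graph as a clique \<open>C\<close> plus an independent set \<open>I\<close>. Hamiltonian paths between clique
  vertices suffice: an independent vertex can be deleted from such a path, since its neighbours
  on the path are in \<open>C\<close>, and reattached at an end. For \<open>u, v \<in> C\<close> start with the paths \<open>[u, v]\<close>
  and \<open>[c]\<close> for the other \<open>c \<in> C\<close>, and use each \<open>a \<in> I\<close> to join the ends of two different paths.
  Three neighbours of \<open>a\<close> that are still ends of paths always allow this, because a path has only
  two ends. If the neighbourhoods are pairwise disjoint, at most one clique vertex is lost as an
  end. Otherwise, freeness from the two stars gives: two intersecting neighbourhoods miss at most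
  one vertex of \<open>C\<close>; a clique vertex has at most three neighbours in \<open>I\<close>; and if it has three,
  every clique vertex is adjacent to two of them. Hence, when \<open>card I \<ge> 4\<close>, all neighbourhoods
  but those of one or two hubs are disjoint, or \<open>card I = 4\<close> with large degrees, and the greedy
  joining succeeds if the vertices of large degree are treated last.
\<close>

section \<open>Triples meeting in pairs\<close>

lemma triple_of_two_pairs:
  assumes E: "finite E" "card E \<le> 3"
    and XY: "X \<union> Y \<subseteq> E \<inter> Z" "card X \<ge> 2" "card Y \<ge> 2" "card (X \<inter> Y) \<le> 1"
  shows "card E = 3 \<and> E \<subseteq> Z"
proof -
  have "finite X" "finite Y"
    using XY(1) E(1) by (auto intro: finite_subset)
  then have "card (X \<union> Y) \<ge> 3"
    using card_Un_Int[of X Y] XY(2-4) by linarith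
  moreover have "card (X \<union> Y) \<le> card (E \<inter> Z)" "card (E \<inter> Z) \<le> card E"
    using XY(1) E(1) by (auto intro: card_mono)
  ultimately have "card (E \<inter> Z) = card E" "card E = 3"
    using E(2) by linarith+
  then show ?thesis
    using card_subset_eq[OF E(1), of "E \<inter> Z"] by auto
qed

context
  fixes F :: "'a set set"
  assumes card_le: "\<And>A. A \<in> F \<Longrightarrow> finite A \<and> card A \<le> 3"
    and meets: "\<And>A B. \<lbrakk>A \<in> F; B \<in> F; card A = 3\<rbrakk> \<Longrightarrow> card (A \<inter> B) \<ge> 2"
begin

lemma triples_subset_Un:
  assumes A: "A \<in> F" "card A = 3" and B: "B \<in> F" "card B = 3" and AB: "card (A \<inter> B) = 2"
    and D: "D \<in> F" "\<not> A \<inter> B \<subseteq> D" and E: "E \<in> F"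
  shows "card E = 3 \<and> E \<subseteq> A \<union> B"
proof -
  have few_common: "card (A \<inter> B \<inter> E) \<le> 1" if "\<not> A \<inter> B \<subseteq> E" for E
  proof -
    have "card (A \<inter> B \<inter> E) < card (A \<inter> B)"
      using that card_le[OF A(1)] by (intro psubset_card_mono) auto
    then show ?thesis using AB by simp
  qed
  have not_common: "card E = 3 \<and> E \<subseteq> A \<union> B" if E: "E \<in> F" "\<not> A \<inter> B \<subseteq> E" for E
    using meets[OF A(1) E(1) A(2)] meets[OF B(1) E(1) B(2)] few_common[OF E(2)] card_le[OF E(1)]
    by (intro triple_of_two_pairs[of E "A \<inter> E" "B \<inter> E"]) (auto simp: Int_ac)
  show ?thesis
  proof (cases "A \<inter> B \<subseteq> E")
    case True
    have "card (A \<inter> B \<inter> (D \<inter> E)) \<le> card (A \<inter> B \<inter> D)"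
      using card_le[OF A(1)] by (intro card_mono) auto
    then show ?thesis
      using True not_common[OF D] few_common[OF D(2)] AB meets[OF D(1) E] card_le[OF E]
      by (intro triple_of_two_pairs[of E "A \<inter> B" "D \<inter> E"]) auto
  qed (rule not_common[OF E])
qed

lemma triples_common_pair_or_four_points:
  assumes A: "A \<in> F" "card A = 3" and "\<not> \<Union>F \<subseteq> A"
  shows "(\<exists>p q. p \<noteq> q \<and> (\<forall>D\<in>F. {p, q} \<subseteq> D)) \<or> card (\<Union>F) = 4 \<and> (\<forall>D\<in>F. card D = 3)"
proof -
  obtain B where B: "B \<in> F" "\<not> B \<subseteq> A"
    using assms(3) by blast
  have "card (A \<inter> B) < card B"
    using B card_le by (intro psubset_card_mono) auto
  then have AB: "card (A \<inter> B) = 2" and card_B: "card B = 3"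
    using meets[OF A(1) B(1) A(2)] card_le[OF B(1)] by auto
  then obtain p q where pq: "A \<inter> B = {p, q}" "p \<noteq> q"
    by (auto simp: card_2_iff)
  show ?thesis
  proof (cases "\<forall>D\<in>F. A \<inter> B \<subseteq> D")
    case True
    then show ?thesis using pq by metis
  next
    case False
    then have triples: "card E = 3 \<and> E \<subseteq> A \<union> B" if "E \<in> F" for E
      using triples_subset_Un[OF A B(1) card_B AB] that by blast
    then have "\<Union>F = A \<union> B"
      using A(1) B(1) by blast
    moreover have "card (A \<union> B) = 4"
      using card_Un_Int[of A B] card_le A B(1) AB card_B by simp
    ultimately show ?thesis using triples by simp
  qed
qed

end

section \<open>Systems of disjoint paths with ends in a clique\<close>

locale finite_clique =
  fixes adj :: "'a \<Rightarrow> 'a \<Rightarrow> bool" and C :: "'a set"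
  assumes adj_sym: "adj x y \<Longrightarrow> adj y x"
    and finite_C: "finite C"
    and adj_C: "\<lbrakk>x \<in> C; y \<in> C; x \<noteq> y\<rbrakk> \<Longrightarrow> adj x y"
begin

definition C_nbrs :: "'a \<Rightarrow> 'a set" where
  "C_nbrs a = {c \<in> C. adj a c}"

definition path :: "'a list \<Rightarrow> bool" where
  "path p \<longleftrightarrow> p \<noteq> [] \<and> distinct p \<and> successively adj p"

definition path_between :: "'a \<Rightarrow> 'a list \<Rightarrow> 'a \<Rightarrow> bool" where
  "path_between u p v \<longleftrightarrow> path p \<and> hd p = u \<and> last p = v"

definition C_path :: "'a list \<Rightarrow> bool" where
  "C_path p \<longleftrightarrow> path p \<and> hd p \<in> C \<and> last p \<in> C"

definition consecutive :: "'a \<Rightarrow> 'a \<Rightarrow> 'a list \<Rightarrow> bool" where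
  "consecutive u v p \<longleftrightarrow> sublist [u, v] p \<or> sublist [v, u] p"

text \<open>
  The two vertices \<open>u\<close> and \<open>v\<close> to be joined by a Hamiltonian path stay consecutive in one of the
  paths: cutting that path between them at the very end makes them the two endpoints.
\<close>

definition path_system :: "'a \<Rightarrow> 'a \<Rightarrow> 'a list set \<Rightarrow> 'a set \<Rightarrow> bool" where
  "path_system u v PS W \<longleftrightarrow> finite PS \<and> (\<forall>P\<in>PS. C_path P) \<and> disjoint_family_on set PS \<and>
    \<Union>(set ` PS) = W \<and> (\<exists>P\<in>PS. consecutive u v P)"

definition ends :: "'a list set \<Rightarrow> 'a set" where
  "ends PS = (\<Union>P\<in>PS. {hd P, last P})"

definition singles :: "'a list set \<Rightarrow> 'a set" where
  "singles PS = {c. [c] \<in> PS}"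

lemma C_nbrs_subset: "C_nbrs a \<subseteq> C"
  by (auto simp: C_nbrs_def)

lemma finite_C_nbrs: "finite (C_nbrs a)"
  using finite_C C_nbrs_subset by (rule finite_subset[rotated])

lemma path_rev: "path p \<Longrightarrow> path (rev p)"
  by (auto simp: path_def intro: successively_mono[of adj] adj_sym)

lemma path_append:
  assumes "path p" "path q" "set p \<inter> set q = {}" "adj (last p) (hd q)"
  shows "path (p @ q)"
  using assms by (simp add: path_def successively_append_iff)

lemma C_path_rev: "C_path p \<Longrightarrow> C_path (rev p)"
  by (auto simp: C_path_def path_rev hd_rev last_rev)

lemma C_path_not_Nil: "C_path p \<Longrightarrow> p \<noteq> []"
  by (simp add: C_path_def path_def)

lemma C_path_append:
  assumes "C_path p" "C_path q" "set p \<inter> set q = {}"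
  shows "C_path (p @ q)"
proof -
  have "adj (last p) (hd q)"
    using assms C_path_not_Nil unfolding C_path_def
    by (metis adj_C disjoint_iff hd_in_set last_in_set)
  then show ?thesis
    using assms C_path_not_Nil by (auto simp: C_path_def path_append)
qed

lemma path_between_rev: "path_between u p v \<Longrightarrow> path_between v (rev p) u"
  by (auto simp: path_between_def path_rev hd_rev last_rev)

lemma consecutive_rev: "consecutive u v (rev p) \<longleftrightarrow> consecutive u v p"
  by (auto simp: consecutive_def sublist_rev_right)

lemma consecutive_appendI:
  "consecutive u v p \<or> consecutive u v q \<Longrightarrow> consecutive u v (p @ m @ q)"
  unfolding consecutive_def
  by (meson sublist_append_leftI sublist_append_rightI sublist_order.order_trans)

lemma ends_join:
  assumes "P \<noteq> []" "Q \<noteq> []" "P' \<in> {P, rev P}" "Q' \<in> {Q, rev Q}"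
  shows "ends PS - {last P', hd Q'} \<subseteq> ends (insert (P' @ M @ Q') (PS - {P, Q}))"
proof -
  have "P' \<noteq> []" "Q' \<noteq> []"
    using assms by auto
  moreover have "{hd P, last P} = {hd P', last P'}" "{hd Q, last Q} = {hd Q', last Q'}"
    using assms by (auto simp: hd_rev last_rev)
  ultimately show ?thesis
    by (fastforce simp: ends_def)
qed

lemma ex_consecutive_join:
  assumes "\<exists>T\<in>PS. consecutive u v T" "P' \<in> {P, rev P}" "Q' \<in> {Q, rev Q}"
  shows "\<exists>T\<in>insert (P' @ M @ Q') (PS - {P, Q}). consecutive u v T"
proof -
  obtain T where T: "T \<in> PS" "consecutive u v T"
    using assms(1) by blast
  show ?thesis
  proof (cases "T \<in> {P, Q}")
    case True
    then have "consecutive u v P' \<or> consecutive u v Q'"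
      using T(2) assms(2,3) by (auto simp: consecutive_rev)
    then show ?thesis
      by (auto intro: consecutive_appendI)
  qed (use T in auto)
qed

lemma path_system_join:
  assumes PS: "path_system u v PS W" and PQ: "P \<in> PS" "Q \<in> PS" "P \<noteq> Q"
    and P': "P' \<in> {P, rev P}" and Q': "Q' \<in> {Q, rev Q}"
    and path: "path (P' @ M @ Q')" and M: "set M \<inter> W = {}"
  defines "PS' \<equiv> insert (P' @ M @ Q') (PS - {P, Q})"
  shows "path_system u v PS' (W \<union> set M)" and "card PS = Suc (card PS')"
proof -
  let ?R = "P' @ M @ Q'"
  have fin: "finite PS" and C_paths: "\<And>S. S \<in> PS \<Longrightarrow> C_path S"
    and disj: "disjoint_family_on set PS" and W: "\<Union>(set ` PS) = W"
    and cons: "\<exists>T\<in>PS. consecutive u v T"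
    using PS by (auto simp: path_system_def)
  have C_path_PQ: "C_path P'" "C_path Q'"
    using C_paths PQ(1,2) P' Q' C_path_rev by auto
  then have ne: "P' \<noteq> []" "Q' \<noteq> []"
    using C_path_not_Nil by auto
  have sets: "set P' = set P" "set Q' = set Q"
    using P' Q' by auto
  have R_disj: "set ?R \<inter> set S = {}" if "S \<in> PS - {P, Q}" for S
    using that disjoint_family_onD[OF disj, of P S] disjoint_family_onD[OF disj, of Q S] PQ M W
    by (auto simp: sets)
  have R_new: "?R \<notin> PS - {P, Q}"
    using R_disj[of ?R] ne by auto
  have "C_path ?R"
    using C_path_PQ ne path by (simp add: C_path_def)
  moreover have "disjoint_family_on set PS'"
    using R_new R_disj disjoint_family_on_mono[OF _ disj, of "PS - {P, Q}"]
    unfolding PS'_def by (subst disjoint_family_on_insert) auto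
  moreover have "\<Union>(set ` PS') = W \<union> set M"
    using W PQ sets by (auto simp: PS'_def)
  ultimately show "path_system u v PS' (W \<union> set M)"
    using fin C_paths ex_consecutive_join[OF cons P' Q'] by (auto simp: path_system_def PS'_def)
  have "card PS = card (PS - {P, Q}) + 2"
    using fin PQ card_mono[of PS "{P, Q}"] by (simp add: card_Diff_subset)
  then show "card PS = Suc (card PS')"
    using fin R_new by (simp add: PS'_def)
qed

lemma path_system_absorb:
  assumes PS: "path_system u v PS W" and a: "a \<notin> W"
    and PQ: "P \<in> PS" "Q \<in> PS" "P \<noteq> Q"
    and p: "p \<in> {hd P, last P}" "adj a p" and q: "q \<in> {hd Q, last Q}" "adj a q"
  obtains R where "path_system u v (insert R (PS - {P, Q})) (insert a W)"
    "card PS = Suc (card (insert R (PS - {P, Q})))"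
    "ends PS - {p, q} \<subseteq> ends (insert R (PS - {P, Q}))"
    "P = [p] \<Longrightarrow> hd R = p" "Q = [q] \<Longrightarrow> last R = q"
proof -
  have C_paths: "C_path P" "C_path Q" and W: "set P \<subseteq> W" "set Q \<subseteq> W"
    and disj: "set P \<inter> set Q = {}"
    using PS PQ by (auto simp: path_system_def dest: disjoint_family_onD)
  obtain P' where P': "P' \<in> {P, rev P}" "last P' = p"
    using p(1) C_path_not_Nil[OF C_paths(1)] by (metis insert_iff last_rev singletonD)
  obtain Q' where Q': "Q' \<in> {Q, rev Q}" "hd Q' = q"
    using q(1) C_path_not_Nil[OF C_paths(2)] by (metis hd_rev insert_iff singletonD)
  have "path P'" "path Q'"
    using P'(1) Q'(1) C_paths path_rev by (auto simp: C_path_def)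
  moreover have "path [a]"
    by (simp add: path_def)
  ultimately have "path (P' @ [a] @ Q')"
    using P' Q' p(2) q(2) adj_sym W a disj by (intro path_append) auto
  from path_system_join[OF PS PQ P'(1) Q'(1) this] show ?thesis
    using P' Q' a ends_join[of P Q P' Q' PS "[a]"] C_paths[THEN C_path_not_Nil]
    by (intro that[of "P' @ [a] @ Q'"]) auto
qed

lemma ends_subset: "path_system u v PS W \<Longrightarrow> ends PS \<subseteq> C"
  by (auto simp: path_system_def ends_def C_path_def)

lemma card_ends_ge:
  assumes PS: "path_system u v PS W" and "u \<noteq> v"
  shows "card (ends PS) \<ge> card PS + 1"
proof -
  have fin: "finite PS" and ne: "\<And>P. P \<in> PS \<Longrightarrow> P \<noteq> []"
    and disj: "\<And>P Q. \<lbrakk>P \<in> PS; Q \<in> PS; P \<noteq> Q\<rbrakk> \<Longrightarrow> set P \<inter> set Q = {}"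
    using PS C_path_not_Nil by (auto simp: path_system_def dest: disjoint_family_onD)
  obtain T where T: "T \<in> PS" "consecutive u v T" "distinct T"
    using PS by (auto simp: path_system_def C_path_def path_def)
  have "length T \<ge> 2"
    using T(2) by (auto simp: consecutive_def dest: sublist_length_le)
  then have "hd T \<noteq> last T"
    using T(3) by (cases T) auto
  then have "last T \<notin> hd ` PS"
    using disj[OF T(1)] ne T(1) by (metis disjoint_iff hd_in_set imageE last_in_set)
  moreover have "inj_on hd PS"
    using disj ne by (metis disjoint_iff hd_in_set inj_onI)
  ultimately have "card PS + 1 = card (insert (last T) (hd ` PS))"
    using fin by (simp add: card_image)
  also have "\<dots> \<le> card (ends PS)"
    using T(1) fin by (intro card_mono) (auto simp: ends_def)
  finally show ?thesis .
qed

lemma path_system_imp_single_path: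
  assumes "path_system u v PS W"
  shows "\<exists>T. path_system u v {T} W"
  using assms
proof (induction "card PS" arbitrary: PS rule: less_induct)
  case less
  then obtain P where P: "P \<in> PS" and PS: "finite PS" "\<forall>P\<in>PS. C_path P" "disjoint_family_on set PS"
    by (auto simp: path_system_def)
  show ?case
  proof (cases "PS = {P}")
    case True
    then show ?thesis using less.prems by blast
  next
    case False
    then obtain Q where Q: "Q \<in> PS" "P \<noteq> Q"
      using P by blast
    have "C_path (P @ [] @ Q)"
      using PS P Q by (simp add: C_path_append disjoint_family_onD)
    then show ?thesis
      using path_system_join[OF less.prems P Q, of P Q "[]"] less.hyps by (auto simp: C_path_def)
  qed
qed

lemma path_system_imp_path_between:
  assumes "path_system u v PS W"
  obtains p where "path_between u p v" "set p = W"
proof -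
  obtain T where T: "C_path T" "set T = W" "consecutive u v T"
    using path_system_imp_single_path[OF assms] by (auto simp: path_system_def)
  have "sublist [v, u] T \<or> sublist [v, u] (rev T)"
    using T(3) by (auto simp: consecutive_def sublist_rev_right)
  then obtain S where S: "C_path S" "set S = W" "sublist [v, u] S"
    using T C_path_rev set_rev by metis
  then obtain X Y where XY: "S = X @ [v, u] @ Y"
    by (auto simp: sublist_def)
  have "last (u # Y) = last S" "hd (X @ [v]) = hd S"
    by (auto simp: XY hd_append)
  then have in_C: "last (u # Y) \<in> C" "hd (X @ [v]) \<in> C"
    using S(1) by (auto simp: C_path_def)
  have halves: "path (u # Y)" "path (X @ [v])" "set (u # Y) \<inter> set (X @ [v]) = {}"
    using S(1) by (auto simp: C_path_def path_def XY successively_append_iff successively_Cons)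
  have "adj (last (u # Y)) (hd (X @ [v]))"
    using in_C halves(3) last_in_set[of "u # Y"] hd_in_set[of "X @ [v]"]
    by (metis adj_C disjoint_iff list.distinct(1) snoc_eq_iff_butlast)
  with halves have "path ((u # Y) @ X @ [v])"
    by (rule path_append)
  then show ?thesis
    using S(2) by (intro that[of "(u # Y) @ X @ [v]"]) (auto simp: path_between_def XY)
qed

lemma path_system_absorb_disjoint:
  assumes "finite L" "path_system u v PS W" "L \<inter> W = {}" "disjoint_family_on C_nbrs L"
    and "\<And>x. x \<in> L \<Longrightarrow> card (C_nbrs x \<inter> singles PS) \<ge> 2"
  shows "\<exists>PS'. path_system u v PS' (W \<union> L) \<and> card PS = card PS' + card L \<and> ends PS \<subseteq> ends PS'"
  using assms
proof (induction L arbitrary: PS W rule: finite_induct)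
  case empty
  then show ?case by auto
next
  case (insert x L)
  have "\<not> card (C_nbrs x \<inter> singles PS) \<le> Suc 0"
    using insert.prems(4)[of x] by simp
  then obtain p q where pq: "p \<noteq> q" "p \<in> C_nbrs x" "[p] \<in> PS" "q \<in> C_nbrs x" "[q] \<in> PS"
    using finite_C_nbrs by (auto simp: card_le_Suc0_iff_eq singles_def)
  then obtain R where R: "path_system u v (insert R (PS - {[p], [q]})) (insert x W)"
    "card PS = Suc (card (insert R (PS - {[p], [q]})))"
    "ends PS - {p, q} \<subseteq> ends (insert R (PS - {[p], [q]}))" "hd R = p" "last R = q"
    using path_system_absorb[OF insert.prems(1), of x "[p]" "[q]" p q] insert.prems(2)
    by (auto simp: C_nbrs_def)
  let ?PS = "insert R (PS - {[p], [q]})"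
  have disj: "C_nbrs x \<inter> C_nbrs y = {}" if "y \<in> L" for y
    using that insert.prems(3) insert.hyps(2) by (auto dest: disjoint_family_onD)
  have "card (C_nbrs y \<inter> singles ?PS) \<ge> 2" if "y \<in> L" for y
  proof -
    have "C_nbrs y \<inter> singles PS \<subseteq> C_nbrs y \<inter> singles ?PS"
      using disj[OF that] pq by (auto simp: singles_def)
    then have "card (C_nbrs y \<inter> singles PS) \<le> card (C_nbrs y \<inter> singles ?PS)"
      using finite_C_nbrs by (intro card_mono) auto
    then show ?thesis using insert.prems(4)[of y] that by auto
  qed
  moreover have "disjoint_family_on C_nbrs L"
    using insert.prems(3) by (rule disjoint_family_on_mono[rotated]) blast
  ultimately obtain PS' where PS': "path_system u v PS' (insert x W \<union> L)"
    "card ?PS = card PS' + card L" "ends ?PS \<subseteq> ends PS'"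
    using insert.IH[OF R(1)] insert.prems(2) insert.hyps(2) by blast
  moreover have "ends PS \<subseteq> ends ?PS"
    using R(3-5) by (auto simp: ends_def)
  ultimately show ?case
    using R(2) insert.hyps by (intro exI[of _ PS']) auto
qed

lemma path_system_initial:
  assumes "u \<in> C" "v \<in> C" "u \<noteq> v"
  obtains PS where "path_system u v PS C" "card PS + 1 = card C" "ends PS = C"
    "singles PS = C - {u, v}"
proof
  let ?PS = "insert [u, v] ((\<lambda>c. [c]) ` (C - {u, v}))"
  show "path_system u v ?PS C"
    using assms finite_C
    by (auto simp: path_system_def disjoint_family_on_def C_path_def path_def consecutive_def adj_C)
  have "card ((\<lambda>c. [c]) ` (C - {u, v})) = card C - 2"
    using assms finite_C by (subst card_image) (auto simp: inj_on_def card_Diff_subset)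
  moreover have "[u, v] \<notin> (\<lambda>c. [c]) ` (C - {u, v})" by auto
  moreover have "card {u, v} \<le> card C"
    using assms finite_C by (intro card_mono) auto
  ultimately show "card ?PS + 1 = card C"
    using assms finite_C by simp
  show "ends ?PS = C" "singles ?PS = C - {u, v}"
    using assms by (auto simp: ends_def singles_def)
qed

definition absorbable :: "'a \<Rightarrow> 'a \<Rightarrow> 'a set \<Rightarrow> nat \<Rightarrow> bool" where
  "absorbable u v J t \<longleftrightarrow> (\<exists>PS. path_system u v PS (C \<union> J) \<and> card PS + card J + 1 = card C \<and>
    card (C - ends PS) \<le> t)"

lemma card_Diff_ends_le:
  assumes "path_system u v PS W" "card PS + k + 1 = card C" "u \<noteq> v"
  shows "card (C - ends PS) \<le> k"
proof -
  have "card (C - ends PS) = card C - card (ends PS)"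
    using ends_subset[OF assms(1)] finite_C by (simp add: card_Diff_subset finite_subset)
  then show ?thesis
    using assms(2) card_ends_ge[OF assms(1,3)] by simp
qed

lemma absorbable_card:
  assumes "absorbable u v J t" "u \<noteq> v"
  shows "absorbable u v J (card J)"
  using assms card_Diff_ends_le[of u v _ "C \<union> J" "card J"] unfolding absorbable_def by blast

lemma path_system_absorb_three_ends:
  assumes PS: "path_system u v PS W" and a: "a \<notin> W" and three: "card (C_nbrs a \<inter> ends PS) \<ge> 3"
  obtains PS' p q where "path_system u v PS' (insert a W)" "card PS = Suc (card PS')"
    "{p, q} \<subseteq> C_nbrs a" "ends PS - {p, q} \<subseteq> ends PS'" "singles PS - {p, q} \<subseteq> singles PS'"
proof -
  have "C_nbrs a \<inter> ends PS \<noteq> {}"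
    using three by auto
  then obtain p where p: "p \<in> C_nbrs a \<inter> ends PS" by blast
  then obtain P where P: "P \<in> PS" "p \<in> {hd P, last P}"
    by (auto simp: ends_def)
  have "\<not> C_nbrs a \<inter> ends PS \<subseteq> {hd P, last P}"
  proof
    assume "C_nbrs a \<inter> ends PS \<subseteq> {hd P, last P}"
    then have "card (C_nbrs a \<inter> ends PS) \<le> card {hd P, last P}" by (intro card_mono) auto
    then show False using three by (simp add: card_insert_if split: if_splits)
  qed
  then obtain q Q where q: "q \<in> C_nbrs a" "q \<notin> {hd P, last P}" and Q: "Q \<in> PS" "q \<in> {hd Q, last Q}"
    by (auto simp: ends_def)
  then have "P \<noteq> Q" by auto
  with p P q Q obtain R where "path_system u v (insert R (PS - {P, Q})) (insert a W)"
    "card PS = Suc (card (insert R (PS - {P, Q})))"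
    "ends PS - {p, q} \<subseteq> ends (insert R (PS - {P, Q}))"
    using path_system_absorb[OF PS a P(1) Q(1), of p q] by (auto simp: C_nbrs_def)
  moreover have "singles PS - {p, q} \<subseteq> singles (insert R (PS - {P, Q}))"
    using P(2) Q(2) by (auto simp: singles_def)
  ultimately show ?thesis
    using p q(1) by (intro that) auto
qed

lemma absorbable_insert:
  assumes "absorbable u v J t" "finite J" "a \<notin> C \<union> J" "card (C_nbrs a) \<ge> t + 3"
  shows "absorbable u v (insert a J) (t + 2)"
proof -
  obtain PS where PS: "path_system u v PS (C \<union> J)" "card PS + card J + 1 = card C"
    "card (C - ends PS) \<le> t"
    using assms(1) by (auto simp: absorbable_def)
  have "card (C_nbrs a) \<le> card ((C_nbrs a \<inter> ends PS) \<union> (C - ends PS))"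
    using finite_C C_nbrs_subset finite_C_nbrs by (intro card_mono) auto
  also have "\<dots> \<le> card (C_nbrs a \<inter> ends PS) + card (C - ends PS)"
    by (rule card_Un_le)
  finally have "card (C_nbrs a \<inter> ends PS) \<ge> 3"
    using PS(3) assms(4) by linarith
  then obtain PS' p q where PS': "path_system u v PS' (insert a (C \<union> J))" "card PS = Suc (card PS')"
    "ends PS - {p, q} \<subseteq> ends PS'"
    by (rule path_system_absorb_three_ends[OF PS(1) assms(3)])
  have "card (C - ends PS') \<le> card ((C - ends PS) \<union> {p, q})"
    using PS'(3) finite_C by (intro card_mono) auto
  also have "\<dots> \<le> card (C - ends PS) + card {p, q}"
    by (rule card_Un_le)
  also have "\<dots> \<le> t + 2"
    using PS(3) by (simp add: card_insert_if)
  finally show ?thesis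
    using PS' PS(2) assms(2,3) unfolding absorbable_def by (intro exI[of _ PS']) auto
qed

lemma card_C_nbrs_Int_Diff_ge_2:
  assumes "card (C_nbrs x) \<ge> 3" "\<not> {u, v} \<subseteq> C_nbrs x"
  shows "card (C_nbrs x \<inter> (C - {u, v})) \<ge> 2"
proof -
  have "card (C_nbrs x \<inter> {u, v}) < card {u, v}"
    using assms(2) by (intro psubset_card_mono) auto
  also have "\<dots> \<le> 2"
    by (simp add: card_insert_if)
  finally have "card (C_nbrs x \<inter> {u, v}) \<le> 1" by simp
  moreover have "C_nbrs x = (C_nbrs x \<inter> (C - {u, v})) \<union> (C_nbrs x \<inter> {u, v})"
    using C_nbrs_subset by blast
  then have "card (C_nbrs x) \<le> card (C_nbrs x \<inter> (C - {u, v})) + card (C_nbrs x \<inter> {u, v})"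
    by (metis card_Un_le)
  ultimately show ?thesis using assms(1) by linarith
qed

context
  fixes u v L
  assumes uv: "u \<in> C" "v \<in> C" "u \<noteq> v"
    and L: "finite L" "L \<inter> C = {}" "\<And>x. x \<in> L \<Longrightarrow> card (C_nbrs x) \<ge> 3"
    and disjoint: "disjoint_family_on C_nbrs L"
begin

lemma path_system_absorb_nbr_of_both:
  obtains J PS where "J \<subseteq> L" "card J \<le> 1" "path_system u v PS (C \<union> J)"
    "card PS + card J + 1 = card C" "\<And>x. x \<in> L - J \<Longrightarrow> card (C_nbrs x \<inter> singles PS) \<ge> 2"
proof -
  obtain PS where PS: "path_system u v PS C" "card PS + 1 = card C" "ends PS = C"
    "singles PS = C - {u, v}"
    using path_system_initial[OF uv] by blast
  show ?thesis
  proof (cases "\<exists>x\<in>L. {u, v} \<subseteq> C_nbrs x")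
    case False
    then show ?thesis
      using PS L(3) card_C_nbrs_Int_Diff_ge_2 by (intro that[of "{}" PS]) auto
  next
    case True
    then obtain x where x: "x \<in> L" "{u, v} \<subseteq> C_nbrs x" by blast
    have "x \<notin> C" "card (C_nbrs x \<inter> ends PS) \<ge> 3"
      using x(1) L C_nbrs_subset[of x] by (auto simp: PS(3) Int_absorb2)
    then obtain PS' p q where PS': "path_system u v PS' (insert x C)" "card PS = Suc (card PS')"
      "{p, q} \<subseteq> C_nbrs x" "singles PS - {p, q} \<subseteq> singles PS'"
      by (rule path_system_absorb_three_ends[OF PS(1)])
    have "card (C_nbrs y \<inter> singles PS') \<ge> 2" if y: "y \<in> L - {x}" for y
    proof -
      have disj: "C_nbrs y \<inter> C_nbrs x = {}"
        using y x(1) by (intro disjoint_family_onD[OF disjoint]) auto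
      then have "C_nbrs y \<inter> (C - {u, v}) \<subseteq> C_nbrs y \<inter> singles PS'"
        using PS'(3,4) PS(4) by blast
      then have "card (C_nbrs y \<inter> (C - {u, v})) \<le> card (C_nbrs y \<inter> singles PS')"
        using finite_C_nbrs by (intro card_mono) auto
      moreover have "\<not> {u, v} \<subseteq> C_nbrs y"
        using disj x(2) by blast
      ultimately show ?thesis
        using card_C_nbrs_Int_Diff_ge_2[of y u v] L(3)[of y] y by auto
    qed
    then show ?thesis
      using x(1) PS' PS(2) by (intro that[of "{x}" PS']) auto
  qed
qed

lemma absorbable_disjoint: "absorbable u v L 1"
proof -
  obtain J PS where J: "J \<subseteq> L" "card J \<le> 1" and PS: "path_system u v PS (C \<union> J)"
    "card PS + card J + 1 = card C" "\<And>x. x \<in> L - J \<Longrightarrow> card (C_nbrs x \<inter> singles PS) \<ge> 2"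
    using path_system_absorb_nbr_of_both by blast
  have "disjoint_family_on C_nbrs (L - J)"
    using disjoint by (rule disjoint_family_on_mono[rotated]) blast
  then obtain PS' where PS': "path_system u v PS' (C \<union> J \<union> (L - J))"
    "card PS = card PS' + card (L - J)" "ends PS \<subseteq> ends PS'"
    using path_system_absorb_disjoint[OF _ PS(1), of "L - J"] L(1,2) PS(3) by blast
  have "card (C - ends PS') \<le> card (C - ends PS)"
    using PS'(3) finite_C by (intro card_mono) auto
  also have "\<dots> \<le> card J"
    using PS(1,2) uv(3) by (rule card_Diff_ends_le)
  finally have "card (C - ends PS') \<le> 1"
    using J(2) by simp
  moreover have "C \<union> J \<union> (L - J) = C \<union> L"
    using J(1) by blast
  moreover have "card L = card J + card (L - J)"
    using J(1) L(1) card_mono[OF L(1) J(1)] by (simp add: card_Diff_subset finite_subset)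
  ultimately show ?thesis
    using PS' PS(2) unfolding absorbable_def by (intro exI[of _ PS']) auto
qed

end

lemma path_bypass:
  assumes p: "path_between u p v" and a: "a \<notin> {u, v}" "\<And>x. x \<in> set p \<Longrightarrow> adj a x \<Longrightarrow> x \<in> C"
  obtains q where "path_between u q v" "set q = set p - {a}"
proof (cases "a \<in> set p")
  case False
  then show ?thesis using p by (intro that[of p]) auto
next
  case True
  then obtain X Y where XY: "p = X @ a # Y" by (meson split_list)
  have ne: "X \<noteq> []" "Y \<noteq> []"
    using p a(1) by (auto simp: XY path_between_def)
  have halves: "path X" "path Y" "set X \<inter> set Y = {}" "a \<notin> set X \<union> set Y"
    and adj: "adj (last X) a" "adj a (hd Y)"
    using p ne
    by (auto simp: XY path_between_def path_def successively_append_iff successively_Cons)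
  have "last X \<in> C" "hd Y \<in> C"
    using a(2) adj ne XY adj_sym by auto
  then have "adj (last X) (hd Y)"
    using halves(3) ne by (metis adj_C disjoint_iff hd_in_set last_in_set)
  with halves(1-3) have "path (X @ Y)"
    by (rule path_append)
  then show ?thesis
    using p ne halves(4) by (intro that[of "X @ Y"]) (auto simp: XY path_between_def)
qed

lemma path_move_start:
  assumes "path_between u p v" "a \<notin> {u, v}" "\<And>x. x \<in> set p \<Longrightarrow> adj a x \<Longrightarrow> x \<in> C" "adj a u"
  obtains q where "path_between a q v" "set q = insert a (set p)"
proof -
  obtain q where q: "path_between u q v" "set q = set p - {a}"
    using path_bypass[OF assms(1-3)] by blast
  then have "path_between a (a # q) v"
    using assms(4) by (auto simp: path_between_def path_def successively_Cons)
  then show ?thesis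
    using q(2) by (intro that[of "a # q"]) auto
qed

end

section \<open>Neighbourhoods in a split graph without large stars\<close>

locale star_free_split = finite_clique adj C for adj :: "'a \<Rightarrow> 'a \<Rightarrow> bool" and C +
  fixes I :: "'a set"
  assumes finite_I: "finite I" and disjoint_IC: "I \<inter> C = {}"
    and indep: "\<lbrakk>a \<in> I; b \<in> I\<rbrakk> \<Longrightarrow> \<not> adj a b"
    and deg_ge_3: "a \<in> I \<Longrightarrow> card (C_nbrs a) \<ge> 3"
    and star_free: "\<lbrakk>distinct [c, w, x, y, z]; adj c w; adj c x; adj c y; adj c z;
      \<not> adj w y; \<not> adj w z; \<not> adj x y; \<not> adj x z; \<not> adj y z\<rbrakk> \<Longrightarrow> False"
begin

definition I_nbrs :: "'a \<Rightarrow> 'a set" where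
  "I_nbrs c = {a \<in> I. adj a c}"

definition overlap :: "'a \<Rightarrow> 'a \<Rightarrow> bool" where
  "overlap a b \<longleftrightarrow> a \<in> I \<and> b \<in> I \<and> a \<noteq> b \<and> C_nbrs a \<inter> C_nbrs b \<noteq> {}"

lemma overlap_sym: "overlap a b \<Longrightarrow> overlap b a"
  by (auto simp: overlap_def)

lemma not_disjoint_imp_overlap:
  assumes "\<not> disjoint_family_on C_nbrs L" "L \<subseteq> I"
  obtains a b where "a \<in> L" "b \<in> L" "overlap a b"
  using assms by (auto simp: disjoint_family_on_def overlap_def)

lemma finite_I_nbrs: "finite (I_nbrs c)"
  using finite_I by (simp add: I_nbrs_def)

lemma C_neq_I: "\<lbrakk>x \<in> C; y \<in> I\<rbrakk> \<Longrightarrow> x \<noteq> y"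
  using disjoint_IC by blast

lemma card_I_nbrs_le_3:
  assumes "c \<in> C"
  shows "card (I_nbrs c) \<le> 3"
proof (rule ccontr)
  assume "\<not> ?thesis"
  then obtain S where S: "S \<subseteq> I_nbrs c" "card S = 4"
    using obtain_subset_with_card_n[of 4 "I_nbrs c"] by auto
  then obtain w x y z where wxyz: "S = {w, x, y, z}" "distinct [w, x, y, z]"
    by (auto simp: numeral_eq_Suc card_Suc_eq)
  then have "w \<in> I" "x \<in> I" "y \<in> I" "z \<in> I" "adj c w" "adj c x" "adj c y" "adj c z"
    using S(1) adj_sym by (auto simp: I_nbrs_def)
  then show False
    using star_free[of c w x y z] wxyz(2) indep C_neq_I[OF assms] by simp
qed

lemma card_I_nbrs_Int_ge_2:
  assumes c: "c \<in> C" and d: "d \<in> C" and three: "card (I_nbrs c) = 3"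
  shows "card (I_nbrs c \<inter> I_nbrs d) \<ge> 2"
proof (rule ccontr)
  assume small: "\<not> ?thesis"
  then have "c \<noteq> d" using three by auto
  have "card (I_nbrs c - I_nbrs d) = card (I_nbrs c) - card (I_nbrs c \<inter> I_nbrs d)"
    using finite_I_nbrs by (intro card_Diff_subset_Int) auto
  then have "card (I_nbrs c - I_nbrs d) \<ge> 2"
    using small three by simp
  then obtain S where S: "S \<subseteq> I_nbrs c - I_nbrs d" "card S = 2"
    using obtain_subset_with_card_n by metis
  then obtain y z where yz: "S = {y, z}" "y \<noteq> z"
    by (auto simp: card_2_iff)
  have "S \<subset> I_nbrs c"
    using S three by auto
  then obtain x where x: "x \<in> I_nbrs c" "x \<notin> {y, z}"
    using yz(1) by blast
  have "x \<in> I" "y \<in> I" "z \<in> I" "adj c x" "adj c y" "adj c z" "\<not> adj d y" "\<not> adj d z"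
    using x(1) S(1) yz(1) adj_sym by (auto simp: I_nbrs_def)
  then show False
    using star_free[of c d x y z] adj_C[OF c d \<open>c \<noteq> d\<close>] \<open>c \<noteq> d\<close> x(2) yz(2) indep
      C_neq_I[OF c] C_neq_I[OF d] by auto
qed

lemma card_missed_le_1:
  assumes "overlap a b"
  shows "card (C - (C_nbrs a \<union> C_nbrs b)) \<le> 1"
proof -
  obtain c where c: "c \<in> C" "adj c a" "adj c b"
    using assms adj_sym by (auto simp: overlap_def C_nbrs_def)
  have "d = e" if de: "d \<in> C - (C_nbrs a \<union> C_nbrs b)" "e \<in> C - (C_nbrs a \<union> C_nbrs b)" for d e
  proof (rule ccontr)
    assume "d \<noteq> e"
    have missed: "\<not> adj d a" "\<not> adj d b" "\<not> adj e a" "\<not> adj e b"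
      using de adj_sym by (auto simp: C_nbrs_def)
    then have "c \<noteq> d" "c \<noteq> e" using c by auto
    then have "adj c d" "adj c e" "distinct [c, d, e, a, b]"
      using adj_C c(1) de \<open>d \<noteq> e\<close> assms C_neq_I by (auto simp: overlap_def)
    then show False
      using star_free[of c d e a b] missed c(2,3) assms indep by (auto simp: overlap_def)
  qed
  then show ?thesis
    using finite_C by (simp add: card_le_Suc0_iff_eq)
qed

lemma card_C_le_deg_add:
  assumes "overlap a b"
  shows "card C \<le> card (C_nbrs a) + card (C_nbrs b)"
proof -
  have "card (C_nbrs a) + card (C_nbrs b) = card (C_nbrs a \<union> C_nbrs b) + card (C_nbrs a \<inter> C_nbrs b)"
    using finite_C_nbrs finite_C_nbrs by (rule card_Un_Int)
  moreover have "card (C_nbrs a \<inter> C_nbrs b) > 0"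
    using assms finite_C_nbrs by (simp add: overlap_def card_gt_0_iff)
  moreover have "card C = card (C_nbrs a \<union> C_nbrs b) + card (C - (C_nbrs a \<union> C_nbrs b))"
    using finite_C C_nbrs_subset finite_C_nbrs by (simp add: card_Diff_subset card_mono)
  ultimately show ?thesis
    using card_missed_le_1[OF assms] by linarith
qed

lemma sum_degrees: "(\<Sum>a\<in>I. card (C_nbrs a)) = (\<Sum>c\<in>C. card (I_nbrs c))"
  using sum_multicount_gen[OF finite_I finite_C, of adj "\<lambda>c. card (I_nbrs c)"]
  by (simp add: C_nbrs_def I_nbrs_def)

lemma card_I_le:
  assumes "\<And>c. c \<in> C \<Longrightarrow> card (I_nbrs c) \<le> k"
  shows "3 * card I \<le> k * card C"
proof -
  have "3 * card I \<le> (\<Sum>a\<in>I. card (C_nbrs a))"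
    using sum_bounded_below[of I 3 "\<lambda>a. card (C_nbrs a)"] deg_ge_3 by (simp add: mult.commute)
  also have "\<dots> \<le> k * card C"
    unfolding sum_degrees using sum_bounded_above[of C "\<lambda>c. card (I_nbrs c)" k] assms
    by (simp add: mult.commute)
  finally show ?thesis .
qed

lemma card_Int_ge_2_if_overlap:
  assumes "overlap x y" "b \<in> I" "C_nbrs b \<inter> C_nbrs y = {}"
  shows "card (C_nbrs b \<inter> C_nbrs x) \<ge> 2"
proof -
  have "C_nbrs b \<subseteq> (C_nbrs b \<inter> C_nbrs x) \<union> (C - (C_nbrs x \<union> C_nbrs y))"
    using assms(3) C_nbrs_subset[of b] by blast
  then have "card (C_nbrs b) \<le> card ((C_nbrs b \<inter> C_nbrs x) \<union> (C - (C_nbrs x \<union> C_nbrs y)))"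
    using finite_C finite_C_nbrs by (intro card_mono) auto
  also have "\<dots> \<le> card (C_nbrs b \<inter> C_nbrs x) + card (C - (C_nbrs x \<union> C_nbrs y))"
    by (rule card_Un_le)
  finally show ?thesis
    using card_missed_le_1[OF assms(1)] deg_ge_3[OF assms(2)] by linarith
qed

section \<open>Absorbing the independent set\<close>

context
  fixes u v
  assumes uv: "u \<in> C" "v \<in> C" "u \<noteq> v"
begin

lemma absorbable_disjoint_subset:
  assumes "L \<subseteq> I" "disjoint_family_on C_nbrs L"
  shows "absorbable u v L 1"
proof (rule absorbable_disjoint[OF uv _ _ _ assms(2)])
  show "finite L" using assms(1) finite_I by (rule finite_subset)
  show "L \<inter> C = {}" using assms(1) disjoint_IC by blast
  show "card (C_nbrs x) \<ge> 3" if "x \<in> L" for x using that assms(1) deg_ge_3 by blast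
qed

lemma absorbable_insert_I:
  assumes "absorbable u v J t" "J \<subseteq> I" "a \<in> I - J" "card (C_nbrs a) \<ge> t + 3"
  shows "absorbable u v (insert a J) (t + 2)"
proof (rule absorbable_insert[OF assms(1)])
  show "finite J" using assms(2) finite_I by (rule finite_subset)
  show "a \<notin> C \<union> J" using assms(3) disjoint_IC by blast
qed (rule assms(4))

lemma absorbable_by_degrees:
  assumes "J \<subseteq> I" "\<And>k. k < card J \<Longrightarrow> card {a \<in> J. card (C_nbrs a) < k + 3} \<le> k"
  shows "absorbable u v J (card J)"
  using finite_subset[OF assms(1) finite_I] assms
proof (induction J rule: finite_psubset_induct)
  case (psubset J)
  show ?case
  proof (cases "J = {}")
    case True
    have "absorbable u v J 1"
      using True by (intro absorbable_disjoint_subset) (auto simp: disjoint_family_on_def)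
    then show ?thesis
      using uv(3) by (rule absorbable_card)
  next
    case False
    then obtain n where n: "card J = Suc n"
      using psubset.hyps by (metis card_eq_0_iff not0_implies_Suc)
    have "{a \<in> J. card (C_nbrs a) < n + 3} \<noteq> J"
      using psubset.prems(2)[of n] n by auto
    then obtain a where a: "a \<in> J" "card (C_nbrs a) \<ge> n + 3" by fastforce
    have "absorbable u v (J - {a}) (card (J - {a}))"
    proof (rule psubset.IH)
      fix k assume "k < card (J - {a})"
      then have "card {x \<in> J. card (C_nbrs x) < k + 3} \<le> k"
        using psubset.prems(2)[of k] a(1) n by simp
      moreover have "card {x \<in> J - {a}. card (C_nbrs x) < k + 3} \<le>
          card {x \<in> J. card (C_nbrs x) < k + 3}"
        using psubset.hyps by (intro card_mono) auto
      ultimately show "card {x \<in> J - {a}. card (C_nbrs x) < k + 3} \<le> k" by linarith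
    qed (use a(1) psubset.prems(1) in auto)
    then have "absorbable u v (insert a (J - {a})) (card (J - {a}) + 2)"
      using a n psubset.prems(1) by (intro absorbable_insert_I) auto
    then show ?thesis
      using a(1) uv(3) absorbable_card by (simp add: insert_absorb)
  qed
qed

lemma absorbable_hub:
  assumes "a \<in> I" "card (C_nbrs a) \<ge> 4" "disjoint_family_on C_nbrs (I - {a})"
  shows "absorbable u v I (card I)"
proof -
  have "absorbable u v (insert a (I - {a})) (1 + 2)"
    using assms by (intro absorbable_insert_I absorbable_disjoint_subset) auto
  then show ?thesis
    using assms(1) uv(3) absorbable_card by (simp add: insert_absorb)
qed

lemma absorbable_if_few_small_degrees:
  assumes few: "card {a \<in> I. card (C_nbrs a) < 5} \<le> 1"
    and "card I \<le> 3 \<or> card I = 4 \<and> (\<exists>a\<in>I. card (C_nbrs a) \<ge> 6)"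
  shows "absorbable u v I (card I)"
proof (rule absorbable_by_degrees)
  fix k assume "k < card I"
  then consider (zero) "k = 0" | (middle) "1 \<le> k" "k \<le> 2"
    | (last) a where "k = 3" "card I = 4" "a \<in> I" "card (C_nbrs a) \<ge> 6"
    using assms(2) by fastforce
  then show "card {a \<in> I. card (C_nbrs a) < k + 3} \<le> k"
  proof cases
    case zero
    then have "{a \<in> I. card (C_nbrs a) < k + 3} = {}"
      using deg_ge_3 by fastforce
    then show ?thesis by (metis card.empty le0)
  next
    case middle
    then have "card {a \<in> I. card (C_nbrs a) < k + 3} \<le> card {a \<in> I. card (C_nbrs a) < 5}"
      using finite_I by (intro card_mono) auto
    then show ?thesis using few middle(1) by linarith
  next
    case last
    then have "a \<in> I - {a \<in> I. card (C_nbrs a) < k + 3}" by simp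
    then have "card {a \<in> I. card (C_nbrs a) < k + 3} < card I"
      using finite_I by (intro psubset_card_mono) blast+
    then show ?thesis using last by simp
  qed
qed simp

end

lemma spanning_path_from_I:
  assumes a: "a \<in> I" "a \<noteq> v"
    and from_C: "\<And>c. c \<in> C \<Longrightarrow> c \<noteq> v \<Longrightarrow> \<exists>p. path_between c p v \<and> set p = C \<union> I"
  shows "\<exists>p. path_between a p v \<and> set p = C \<union> I"
proof -
  have "\<not> C_nbrs a \<subseteq> {v}"
    using deg_ge_3[OF a(1)] card_mono[of "{v}" "C_nbrs a"] by auto
  then obtain c where c: "c \<in> C" "c \<noteq> v" "adj a c"
    by (auto simp: C_nbrs_def)
  then obtain p where p: "path_between c p v" "set p = C \<union> I"
    using from_C by blast
  have new: "a \<notin> {c, v}"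
    using a c(1) C_neq_I by blast
  have nbrs_in_C: "x \<in> C" if "x \<in> set p" "adj a x" for x
    using that p(2) indep[OF a(1)] by blast
  obtain q where "path_between a q v" "set q = insert a (set p)"
    by (rule path_move_start[OF p(1) new nbrs_in_C c(3)])
  then show ?thesis
    using a(1) p(2) by auto
qed

end

section \<open>Hamiltonian paths in large star-free split graphs\<close>

locale large_star_free_split = star_free_split adj C I
  for adj :: "'a \<Rightarrow> 'a \<Rightarrow> bool" and C I +
  assumes card_ge_13: "card C + card I \<ge> 13"
begin

lemma card_C_ge_7: "card C \<ge> 7"
  using card_I_le[OF card_I_nbrs_le_3] card_ge_13 by linarith

context
  fixes u v
  assumes uv: "u \<in> C" "v \<in> C" "u \<noteq> v"
begin

lemma absorbable_two_hubs:
  assumes pq: "p \<noteq> q" "\<And>c. c \<in> C \<Longrightarrow> {p, q} \<subseteq> I_nbrs c"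
  shows "absorbable u v I (card I)"
proof -
  have in_I: "p \<in> I" "q \<in> I"
    using pq(2)[OF uv(1)] by (auto simp: I_nbrs_def)
  have "C_nbrs p = C" "C_nbrs q = C"
    using pq(2) by (auto simp: C_nbrs_def I_nbrs_def)
  then have full: "card (C_nbrs p) \<ge> 7" "card (C_nbrs q) \<ge> 7"
    using card_C_ge_7 by simp_all
  have "disjoint_family_on C_nbrs (I - {p, q})"
  proof (rule ccontr)
    assume "\<not> ?thesis"
    then obtain x y where xy: "x \<in> I - {p, q}" "y \<in> I - {p, q}" "overlap x y"
      by (rule not_disjoint_imp_overlap) auto
    then obtain c where c: "c \<in> C" "{x, y} \<subseteq> I_nbrs c"
      by (auto simp: overlap_def C_nbrs_def I_nbrs_def)
    then have "card {p, q, x, y} \<le> card (I_nbrs c)"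
      using pq(2) finite_I_nbrs by (intro card_mono) auto
    then show False
      using card_I_nbrs_le_3[OF c(1)] pq(1) xy by (auto simp: overlap_def)
  qed
  then have "absorbable u v (I - {p, q}) 1"
    by (intro absorbable_disjoint_subset[OF uv]) auto
  then have "absorbable u v (insert p (I - {p, q})) (1 + 2)"
    by (rule absorbable_insert_I[OF uv]) (use in_I pq(1) full in auto)
  then have "absorbable u v (insert q (insert p (I - {p, q}))) (1 + 2 + 2)"
    by (rule absorbable_insert_I[OF uv]) (use in_I pq(1) full in auto)
  moreover have "insert q (insert p (I - {p, q})) = I"
    using in_I by auto
  ultimately show ?thesis
    using uv(3) absorbable_card by metis
qed

lemma absorbable_if_card_I_le_3:
  assumes "card I \<le> 3"
  shows "absorbable u v I (card I)"
proof (cases "disjoint_family_on C_nbrs I")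
  case True
  then show ?thesis
    using absorbable_card[OF absorbable_disjoint_subset[OF uv] uv(3)] by simp
next
  case False
  have ex_large: "\<exists>h\<in>{a, b}. card (C_nbrs h) \<ge> 5" if "overlap a b" for a b
    using card_C_le_deg_add[OF that] assms card_ge_13 by auto
  obtain h where h: "h \<in> I" "card (C_nbrs h) \<ge> 5"
    using not_disjoint_imp_overlap[OF False] ex_large by blast
  show ?thesis
  proof (cases "disjoint_family_on C_nbrs (I - {h})")
    case True
    then show ?thesis using h by (intro absorbable_hub[OF uv]) auto
  next
    case False
    then obtain g where g: "g \<in> I - {h}" "card (C_nbrs g) \<ge> 5"
      using not_disjoint_imp_overlap[of "I - {h}"] ex_large by blast
    have "card {a \<in> I. card (C_nbrs a) < 5} \<le> card (I - {g, h})"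
      using g h finite_I by (intro card_mono) auto
    also have "\<dots> \<le> 1"
      using g h(1) assms finite_I by (simp add: card_Diff_subset)
    finally show ?thesis
      using assms by (intro absorbable_if_few_small_degrees[OF uv]) auto
  qed
qed

lemma absorbable_if_card_I_eq_4:
  assumes card_I: "card I = 4" and triples: "\<And>c. c \<in> C \<Longrightarrow> card (I_nbrs c) = 3"
  shows "absorbable u v I (card I)"
proof (rule absorbable_if_few_small_degrees[OF uv])
  have card_C: "card C \<ge> 9"
    using card_ge_13 card_I by simp
  have cover: "C \<subseteq> C_nbrs a \<union> C_nbrs b" if ab: "a \<in> I" "b \<in> I" "a \<noteq> b" for a b
  proof
    fix c assume c: "c \<in> C"
    show "c \<in> C_nbrs a \<union> C_nbrs b"
    proof (rule ccontr)
      assume "c \<notin> C_nbrs a \<union> C_nbrs b"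
      then have "card (I_nbrs c) \<le> card (I - {a, b})"
        using c finite_I by (intro card_mono) (auto simp: C_nbrs_def I_nbrs_def)
      then show False
        using triples[OF c] ab card_I finite_I by (simp add: card_Diff_subset)
    qed
  qed
  have "card (C_nbrs a) + card (C_nbrs b) \<ge> 9" if "a \<in> I" "b \<in> I" "a \<noteq> b" for a b
    using card_mono[OF _ cover[OF that]] card_Un_le[of "C_nbrs a" "C_nbrs b"] card_C
    by (simp add: finite_C_nbrs)
  then have "a = b" if "a \<in> I" "card (C_nbrs a) < 5" "b \<in> I" "card (C_nbrs b) < 5" for a b
    using that by fastforce
  then show "card {a \<in> I. card (C_nbrs a) < 5} \<le> 1"
    using finite_I by (simp add: card_le_Suc0_iff_eq)
  have "\<exists>a\<in>I. card (C_nbrs a) \<ge> 6"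
  proof (rule ccontr)
    assume "\<not> ?thesis"
    then have "(\<Sum>a\<in>I. card (C_nbrs a)) \<le> card I * 5"
      using sum_bounded_above[of I "\<lambda>a. card (C_nbrs a)" 5] by fastforce
    then show False
      using card_C card_I triples by (simp add: sum_degrees)
  qed
  then show "card I \<le> 3 \<or> card I = 4 \<and> (\<exists>a\<in>I. card (C_nbrs a) \<ge> 6)"
    using card_I by simp
qed

lemma absorbable_if_triple:
  assumes "card I \<ge> 4" and c: "c \<in> C" "card (I_nbrs c) = 3"
  shows "absorbable u v I (card I)"
proof -
  have "C_nbrs a \<noteq> {}" if "a \<in> I" for a
    using deg_ge_3[OF that] by auto
  then have I: "I = \<Union>(I_nbrs ` C)"
    by (fastforce simp: C_nbrs_def I_nbrs_def)
  have "\<not> I \<subseteq> I_nbrs c"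
    using card_mono[OF finite_I_nbrs, of I c] assms(1) c(2) by auto
  then have "(\<exists>p q. p \<noteq> q \<and> (\<forall>A\<in>I_nbrs ` C. {p, q} \<subseteq> A)) \<or>
      card (\<Union>(I_nbrs ` C)) = 4 \<and> (\<forall>A\<in>I_nbrs ` C. card A = 3)"
    using c finite_I_nbrs card_I_nbrs_le_3 card_I_nbrs_Int_ge_2 I
    by (intro triples_common_pair_or_four_points[of _ "I_nbrs c"]) auto
  then consider p q where "p \<noteq> q" "\<And>d. d \<in> C \<Longrightarrow> {p, q} \<subseteq> I_nbrs d"
    | "card I = 4" "\<And>d. d \<in> C \<Longrightarrow> card (I_nbrs d) = 3"
    using I by auto
  then show ?thesis
    by cases (rule absorbable_two_hubs absorbable_if_card_I_eq_4; assumption)+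
qed

end

context
  assumes card_I_nbrs_le_2: "\<And>c. c \<in> C \<Longrightarrow> card (I_nbrs c) \<le> 2"
begin

lemma card_C_ge_8: "card C \<ge> 8"
  using card_I_le[OF card_I_nbrs_le_2] card_ge_13 by linarith

lemma three_C_nbrs_Int_empty:
  assumes "{a, b, x} \<subseteq> I" "distinct [a, b, x]"
  shows "C_nbrs a \<inter> C_nbrs b \<inter> C_nbrs x = {}"
proof (rule ccontr)
  assume "\<not> ?thesis"
  then obtain c where c: "c \<in> C" "{a, b, x} \<subseteq> I_nbrs c"
    using assms(1) by (auto simp: C_nbrs_def I_nbrs_def)
  then have "card {a, b, x} \<le> card (I_nbrs c)"
    using finite_I_nbrs by (intro card_mono) auto
  then show False
    using card_I_nbrs_le_2[OF c(1)] assms(2) by simp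
qed

lemma card_Int_le_1_if_overlap:
  assumes xy: "overlap x y" and "{a, b} \<subseteq> I" "distinct [a, b, x, y]"
  shows "card (C_nbrs a \<inter> C_nbrs b) \<le> 1"
proof -
  have "C_nbrs a \<inter> C_nbrs b \<inter> C_nbrs x = {}" "C_nbrs a \<inter> C_nbrs b \<inter> C_nbrs y = {}"
    using assms by (auto intro!: three_C_nbrs_Int_empty simp: overlap_def)
  then have "C_nbrs a \<inter> C_nbrs b \<subseteq> C - (C_nbrs x \<union> C_nbrs y)"
    using C_nbrs_subset[of a] by blast
  then have "card (C_nbrs a \<inter> C_nbrs b) \<le> card (C - (C_nbrs x \<union> C_nbrs y))"
    using finite_C by (intro card_mono) auto
  then show ?thesis
    using card_missed_le_1[OF xy] by linarith
qed

lemma overlap_cross: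
  assumes ab: "overlap a b" and xy: "overlap x y" and distinct: "distinct [a, b, x, y]"
  shows "overlap b y"
proof (rule ccontr)
  have in_I: "{a, b, x, y} \<subseteq> I"
    using ab xy by (auto simp: overlap_def)
  assume "\<not> overlap b y"
  then have empty: "C_nbrs b \<inter> C_nbrs y = {}"
    using in_I distinct by (auto simp: overlap_def)
  then have "card (C_nbrs y \<inter> C_nbrs a) \<ge> 2"
    using in_I by (intro card_Int_ge_2_if_overlap[OF ab]) auto
  then have "overlap a y"
    using in_I distinct by (fastforce simp: overlap_def Int_commute)
  then have "card (C_nbrs b \<inter> C_nbrs x) \<le> 1"
    using in_I distinct by (intro card_Int_le_1_if_overlap) auto
  moreover have "card (C_nbrs b \<inter> C_nbrs x) \<ge> 2"
    using in_I empty by (intro card_Int_ge_2_if_overlap[OF xy]) auto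
  ultimately show False by simp
qed

lemma no_disjoint_overlaps:
  assumes ab: "overlap a b" and xy: "overlap x y" and distinct: "distinct [a, b, x, y]"
  shows False
proof -
  have cross: "overlap b y" "overlap b x" "overlap a y" "overlap a x"
    using overlap_cross[of a b x y] overlap_cross[of a b y x] overlap_cross[of b a x y]
      overlap_cross[of b a y x] ab xy distinct overlap_sym by auto
  have in_I: "{a, b, x, y} \<subseteq> I"
    using ab xy by (auto simp: overlap_def)
  have crossings: "card (C_nbrs a \<inter> C_nbrs x) \<le> 1" "card (C_nbrs a \<inter> C_nbrs y) \<le> 1"
    "card (C_nbrs b \<inter> C_nbrs x) \<le> 1" "card (C_nbrs b \<inter> C_nbrs y) \<le> 1"
    using cross[THEN card_Int_le_1_if_overlap] in_I distinct by auto
  have card_Un: "card (S \<union> T) \<le> m + n" if "card S \<le> m" "card T \<le> n" for S T :: "'a set" and m n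
    using card_Un_le[of S T] that by linarith
  let ?cover = "((C - (C_nbrs a \<union> C_nbrs b)) \<union> (C - (C_nbrs x \<union> C_nbrs y))) \<union>
    (((C_nbrs a \<inter> C_nbrs x) \<union> (C_nbrs a \<inter> C_nbrs y)) \<union>
      ((C_nbrs b \<inter> C_nbrs x) \<union> (C_nbrs b \<inter> C_nbrs y)))"
  have "card ?cover \<le> (1 + 1) + ((1 + 1) + (1 + 1))"
    by (intro card_Un card_missed_le_1 ab xy crossings)
  moreover have "C \<subseteq> ?cover"
    by blast
  then have "card C \<le> card ?cover"
    using finite_C finite_C_nbrs by (intro card_mono) auto
  ultimately show False
    using card_C_ge_8 by simp
qed

lemma no_overlap_triangle:
  assumes "overlap a b" "overlap a z" "overlap b z" "card I \<ge> 4"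
  shows False
proof -
  have "\<not> I \<subseteq> {a, b, z}"
    using assms card_mono[of "{a, b, z}" I]
    by (auto simp: overlap_def card_insert_if split: if_splits)
  then obtain x where x: "x \<in> I" "x \<notin> {a, b, z}" by blast
  have "\<not> overlap x a" "\<not> overlap x b"
    using no_disjoint_overlaps[of x a b z] no_disjoint_overlaps[of x b a z] x assms
    by (auto simp: overlap_def)
  then have "C_nbrs x \<inter> C_nbrs a = {}" "C_nbrs x \<inter> C_nbrs b = {}"
    using x assms(1) by (auto simp: overlap_def)
  then show False
    using card_Int_ge_2_if_overlap[OF assms(1) x(1)] by simp
qed

lemma ex_hub:
  assumes ab: "overlap a b" and "card (C_nbrs b) \<ge> 4" and card_I: "card I \<ge> 4"
  shows "\<exists>h\<in>I. card (C_nbrs h) \<ge> 4 \<and> disjoint_family_on C_nbrs (I - {h})"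
proof (cases "disjoint_family_on C_nbrs (I - {b})")
  case True
  then show ?thesis using assms by (auto simp: overlap_def)
next
  case False
  then obtain s t where st: "s \<in> I - {b}" "t \<in> I - {b}" "overlap s t"
    by (rule not_disjoint_imp_overlap) auto
  then have "a = s \<or> a = t"
    using no_disjoint_overlaps[OF ab st(3)] ab by (auto simp: overlap_def)
  then obtain x where x: "x \<noteq> b" "overlap a x"
    using st overlap_sym by blast
  have disj: "disjoint_family_on C_nbrs (I - {a})"
  proof (rule ccontr)
    assume "\<not> ?thesis"
    then obtain s t where st: "s \<in> I - {a}" "t \<in> I - {a}" "overlap s t"
      by (rule not_disjoint_imp_overlap) auto
    then have "b \<in> {s, t}" "x \<in> {s, t}"
      using no_disjoint_overlaps[OF ab st(3)] no_disjoint_overlaps[OF x(2) st(3)] ab x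
      by (auto simp: overlap_def)
    then have "overlap b x"
      using st(3) x(1) overlap_sym by blast
    then show False
      using no_overlap_triangle[OF ab x(2)] card_I by blast
  qed
  have "C_nbrs b \<inter> C_nbrs x = {}"
    using disj ab x by (intro disjoint_family_onD) (auto simp: overlap_def)
  then have "card (C_nbrs b) + card (C_nbrs x) = card (C_nbrs b \<union> C_nbrs x)"
    using finite_C_nbrs by (simp add: card_Un_disjoint)
  also have "\<dots> \<le> card C"
    using finite_C C_nbrs_subset by (intro card_mono) auto
  finally have "card (C_nbrs a) \<ge> 4"
    using card_C_le_deg_add[OF ab] card_C_le_deg_add[OF x(2)] card_C_ge_8 by linarith
  then show ?thesis
    using disj ab by (auto simp: overlap_def)
qed

lemma absorbable_if_no_triple:
  assumes uv: "u \<in> C" "v \<in> C" "u \<noteq> v" and card_I: "card I \<ge> 4"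
  shows "absorbable u v I (card I)"
proof (cases "disjoint_family_on C_nbrs I")
  case True
  then show ?thesis
    using absorbable_card[OF absorbable_disjoint_subset[OF uv] uv(3)] by simp
next
  case False
  then obtain a b where ab: "overlap a b"
    by (rule not_disjoint_imp_overlap) auto
  have "card (C_nbrs a) \<ge> 4 \<or> card (C_nbrs b) \<ge> 4"
    using card_C_le_deg_add[OF ab] card_C_ge_8 by linarith
  then show ?thesis
    using ex_hub[OF ab _ card_I] ex_hub[OF overlap_sym[OF ab] _ card_I]
      absorbable_hub[OF uv] by blast
qed

end

lemma absorbable_I:
  assumes "u \<in> C" "v \<in> C" "u \<noteq> v"
  shows "absorbable u v I (card I)"
proof -
  have "card I \<le> 3 \<or> card I \<ge> 4" by linarith
  then consider (few) "card I \<le> 3" | (triple) c where "card I \<ge> 4" "c \<in> C" "card (I_nbrs c) = 3"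
    | (no_triple) "card I \<ge> 4" "\<forall>c\<in>C. card (I_nbrs c) \<noteq> 3"
    by blast
  then show ?thesis
  proof cases
    case few
    then show ?thesis by (rule absorbable_if_card_I_le_3[OF assms])
  next
    case triple
    then show ?thesis by (rule absorbable_if_triple[OF assms])
  next
    case no_triple
    have "card (I_nbrs c) \<le> 2" if "c \<in> C" for c
      using card_I_nbrs_le_3[OF that] no_triple(2) that by fastforce
    then show ?thesis
      using absorbable_if_no_triple[OF _ assms no_triple(1)] by blast
  qed
qed

lemma ex_spanning_path:
  assumes "u \<in> C \<union> I" "v \<in> C \<union> I" "u \<noteq> v"
  shows "\<exists>p. path_between u p v \<and> set p = C \<union> I"
proof -
  have C_to_C: "\<exists>p. path_between c p d \<and> set p = C \<union> I" if "c \<in> C" "d \<in> C" "c \<noteq> d" for c d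
    using absorbable_I[OF that] path_system_imp_path_between unfolding absorbable_def by metis
  have to_C: "\<exists>p. path_between x p d \<and> set p = C \<union> I" if "x \<in> C \<union> I" "d \<in> C" "x \<noteq> d" for x d
    using that C_to_C spanning_path_from_I[of x d] by blast
  have "\<exists>p. path_between c p x \<and> set p = C \<union> I" if "x \<in> C \<union> I" "c \<in> C" "c \<noteq> x" for x c
    using to_C[of x c] that path_between_rev set_rev by metis
  then show ?thesis
    using assms spanning_path_from_I[of u v] by blast
qed

end

section \<open>Translation to graphs\<close>

lemma digraph_iso_induced_image:
  assumes G: "pair_wf_digraph G" and F: "pair_wf_digraph F" and inj: "inj_on \<phi> (pverts F)"
    and arcs: "\<And>i j. \<lbrakk>i \<in> pverts F; j \<in> pverts F\<rbrakk> \<Longrightarrow> (\<phi> i, \<phi> j) \<in> parcs G \<longleftrightarrow> (i, j) \<in> parcs F"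
  shows "digraph_iso (with_proj G \<restriction> \<phi> ` pverts F) (with_proj F)"
proof -
  interpret G: pair_wf_digraph G by fact
  interpret F: pair_wf_digraph F by fact
  let ?H = "with_proj G \<restriction> \<phi> ` pverts F"
  define f where "f = \<lparr>iso_verts = \<phi>, iso_arcs = map_prod \<phi> \<phi>, iso_head = snd, iso_tail = fst\<rparr>"
  have inj_arcs: "inj_on (map_prod \<phi> \<phi>) (parcs F)"
    by (rule inj_on_subset[OF map_prod_inj_on[OF inj inj]]) (use F.wellformed' in auto)
  have "map_prod \<phi> \<phi> ` parcs F = arcs ?H"
  proof
    show "map_prod \<phi> \<phi> ` parcs F \<subseteq> arcs ?H"
      using arcs F.wellformed' by auto
    show "arcs ?H \<subseteq> map_prod \<phi> \<phi> ` parcs F"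
    proof
      fix e assume "e \<in> arcs ?H"
      then obtain i j where "i \<in> pverts F" "j \<in> pverts F" "e = (\<phi> i, \<phi> j)" "e \<in> parcs G"
        by (cases e) auto
      then show "e \<in> map_prod \<phi> \<phi> ` parcs F"
        using arcs by (intro image_eqI[of _ _ "(i, j)"]) auto
    qed
  qed
  then have "?H = app_iso f (with_proj F)"
    by (simp add: app_iso_def f_def induce_subgraph_def)
  moreover have "F.digraph_isomorphism f"
    using F.wf_digraph inj inj_arcs by (auto simp: F.digraph_isomorphism_def f_def)
  ultimately have "digraph_iso (with_proj F) ?H"
    by (auto simp: digraph_iso_def)
  then show ?thesis
    using F.wf_digraph by (rule digraph_iso_swap[rotated])
qed

lemma induced_freeD:
  assumes "induced_free \<F> G" "F \<in> \<F>" "pair_wf_digraph G" "pair_wf_digraph F"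
    and "inj_on \<phi> (pverts F)" "\<phi> ` pverts F \<subseteq> pverts G"
    and "\<And>i j. \<lbrakk>i \<in> pverts F; j \<in> pverts F\<rbrakk> \<Longrightarrow> (\<phi> i, \<phi> j) \<in> parcs G \<longleftrightarrow> (i, j) \<in> parcs F"
  shows False
proof -
  interpret G: pair_wf_digraph G by fact
  have "induced_subgraph (with_proj G \<restriction> \<phi> ` pverts F) (with_proj G)"
    using assms(6) by (intro G.induced_induce) simp
  then show False
    using digraph_iso_induced_image[OF assms(3-5,7)] assms(1,2) unfolding induced_free_def by blast
qed

lemma (in pair_graph) parcs_sym: "(x, y) \<in> parcs G \<longleftrightarrow> (y, x) \<in> parcs G"
  using pair_sym_arcs by (auto simp: symmetric_def sym_def)

lemma (in pair_graph) parcs_irrefl: "(x, x) \<notin> parcs G"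
  using pair_no_loops by fastforce

lemma (in pair_graph) induced_free_star:
  assumes free: "induced_free {K14, K14_plus_e} G" and dist: "distinct [c, w, x, y, z]"
    and center: "(c, w) \<in> parcs G" "(c, x) \<in> parcs G" "(c, y) \<in> parcs G" "(c, z) \<in> parcs G"
    and leaves: "(w, y) \<notin> parcs G" "(w, z) \<notin> parcs G" "(x, y) \<notin> parcs G" "(x, z) \<notin> parcs G"
      "(y, z) \<notin> parcs G"
  shows False
proof -
  define \<phi> where "\<phi> = (\<lambda>i::nat. [c, w, x, y, z] ! i)"
  define F where "F = (if (w, x) \<in> parcs G then K14_plus_e else K14)"
  have verts: "pverts F = {0, 1, 2, 3, 4}"
    by (simp add: F_def K14_plus_e_def K14_def)
  have \<phi>: "\<phi> 0 = c" "\<phi> 1 = w" "\<phi> (Suc 0) = w" "\<phi> 2 = x" "\<phi> 3 = y" "\<phi> 4 = z"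
    by (simp_all add: \<phi>_def)
  show False
  proof (rule induced_freeD[OF free])
    show "F \<in> {K14, K14_plus_e}" by (simp add: F_def)
    show "pair_wf_digraph G" by unfold_locales
    show "pair_wf_digraph F"
      by unfold_locales (auto simp: F_def K14_plus_e_def K14_def split: if_splits)
    show "inj_on \<phi> (pverts F)"
      using dist by (auto simp: verts \<phi> inj_on_def)
    show "\<phi> ` pverts F \<subseteq> pverts G"
      using center wellformed' by (auto simp: verts \<phi>)
    have center': "(w, c) \<in> parcs G" "(x, c) \<in> parcs G" "(y, c) \<in> parcs G" "(z, c) \<in> parcs G"
      and leaves': "(y, w) \<notin> parcs G" "(z, w) \<notin> parcs G" "(y, x) \<notin> parcs G" "(z, x) \<notin> parcs G"
        "(z, y) \<notin> parcs G"
      and edge: "(x, w) \<in> parcs G \<longleftrightarrow> (w, x) \<in> parcs G"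
      using center leaves parcs_sym by blast+
    show "(\<phi> i, \<phi> j) \<in> parcs G \<longleftrightarrow> (i, j) \<in> parcs F" if "i \<in> pverts F" "j \<in> pverts F" for i j
      using that[unfolded verts] unfolding F_def
      by (elim insertE emptyE)
        (simp_all add: \<phi> K14_def K14_plus_e_def center center' leaves leaves' edge parcs_irrefl)
  qed
qed

lemma (in pair_graph) card_nbrs_ge_if_k_connected:
  assumes conn: "k_connected k G" and a: "a \<in> pverts G"
  shows "card {c. (a, c) \<in> parcs G} \<ge> k"
proof (rule ccontr)
  let ?N = "{c. (a, c) \<in> parcs G}"
  let ?H = "with_proj G \<restriction> (pverts G - ?N)"
  assume "\<not> ?thesis"
  then have lt: "card ?N < k" by simp
  have N: "?N \<subseteq> pverts G"
    using wellformed' by auto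
  then have "Digraph_Component.connected ?H"
    using conn lt by (simp add: k_connected_def)
  moreover have "symmetric ?H"
    using parcs_sym by (auto simp: symmetric_conv)
  ultimately have sc: "strongly_connected ?H"
    by (intro wf_digraph.symmetric_connected_imp_strongly_connected wellformed_induce_subgraph)
  have "card (insert a ?N) \<le> k"
    using lt card_insert_le_m1[of k ?N a] by simp
  then have "\<not> pverts G \<subseteq> insert a ?N"
    using conn N card_mono[of "insert a ?N" "pverts G"] finite_subset[OF N pair_finite_verts]
    by (auto simp: k_connected_def)
  then obtain w where w: "w \<in> pverts G - ?N" "w \<noteq> a" by blast
  then have "a \<rightarrow>\<^sup>*\<^bsub>?H\<^esub> w"
    using sc a parcs_irrefl by (auto simp: strongly_connected_def)
  then obtain y where "a \<rightarrow>\<^bsub>?H\<^esub> y"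
    using w(2) by (auto simp: reachable_def elim: converse_rtrancl_on_cases)
  then show False
    by (auto simp: arcs_ends_conv)
qed

lemma apath_of_list:
  assumes "p \<noteq> []" "distinct p" "successively (\<lambda>x y. (x, y) \<in> parcs G) p" "set p \<subseteq> pverts G"
  shows "pre_digraph.apath (with_proj G) (hd p) (vwalk_arcs p) (last p)"
    and "pre_digraph.awalk_verts (with_proj G) (hd p) (vwalk_arcs p) = p"
proof -
  have walk: "pcas (hd p) (vwalk_arcs p) (last p) \<and> set (vwalk_arcs p) \<subseteq> parcs G \<and>
      pawalk_verts (hd p) (vwalk_arcs p) = p"
    using assms(1,3) by (induction p rule: vwalk_arcs.induct) auto
  then show "pre_digraph.awalk_verts (with_proj G) (hd p) (vwalk_arcs p) = p"
    by (simp add: awalk_verts_with_proj_eq)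
  then show "pre_digraph.apath (with_proj G) (hd p) (vwalk_arcs p) (last p)"
    using walk assms hd_in_set[OF assms(1)]
    by (auto simp: pre_digraph.apath_def pre_digraph.awalk_def cas_with_proj_eq)
qed

lemma (in pair_graph) large_star_free_splitI:
  assumes conn: "k_connected 3 G" and card: "card (pverts G) \<ge> 13"
    and free: "induced_free {K14, K14_plus_e} G"
    and CI: "pverts G = C \<union> I" "C \<inter> I = {}" "clique G C" "independent_set G I"
  shows "large_star_free_split (\<lambda>x y. (x, y) \<in> parcs G) C I"
proof -
  have fin: "finite C" "finite I"
    using pair_finite_verts CI(1) by auto
  interpret finite_clique "\<lambda>x y. (x, y) \<in> parcs G" C
    using fin CI(3) parcs_sym by unfold_locales (auto simp: clique_def)
  show ?thesis
  proof unfold_locales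
    show "finite I" "I \<inter> C = {}" using fin CI(2) by auto
    show "card C + card I \<ge> 13"
      using card CI(1,2) fin by (simp add: card_Un_disjoint)
    show indep: "(a, b) \<notin> parcs G" if "a \<in> I" "b \<in> I" for a b
      using CI(4) that by (auto simp: independent_set_def)
    have "C_nbrs a = {c. (a, c) \<in> parcs G}" if a: "a \<in> I" for a
      using indep[OF a] wellformed' CI(1) unfolding C_nbrs_def by blast
    then show "card (C_nbrs a) \<ge> 3" if "a \<in> I" for a
      using card_nbrs_ge_if_k_connected[OF conn] that CI(1) by simp
  qed (rule induced_free_star[OF free])
qed

theorem theorem1p8:
  fixes G :: "'a pair_pre_digraph"
  assumes "pair_graph G"
    and "k_connected 3 G"
    and "split_graph G"
    and "card (pverts G) \<ge> 13"
    and "induced_free {K14, K14_plus_e} G"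
  shows "hamilton_connected G"
  unfolding hamilton_connected_def
proof (intro ballI impI)
  fix u v assume uv: "u \<in> pverts G" "v \<in> pverts G" "u \<noteq> v"
  obtain C I where CI: "pverts G = C \<union> I" "C \<inter> I = {}" "clique G C" "independent_set G I"
    using assms(3) unfolding split_graph_def by blast
  interpret large_star_free_split "\<lambda>x y. (x, y) \<in> parcs G" C I
    using pair_graph.large_star_free_splitI[OF assms(1,2,4,5) CI] .
  obtain p where p: "path_between u p v" "set p = pverts G"
    using ex_spanning_path[of u v] uv CI(1) by auto
  then show "\<exists>p. pre_digraph.apath (with_proj G) u p v \<and>
      set (pre_digraph.awalk_verts (with_proj G) u p) = pverts G"
    using apath_of_list[of p G]
    by (intro exI[of _ "vwalk_arcs p"]) (auto simp: path_between_def path_def)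
qed

end
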